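(* Let $V$ be a subset of $\mathbb{R}^+$ containing $\mathbb{Q}^+$, let $V_*=V\setminus\{0\}$, and let $\mathbf{s}$ be a function assigning to each $r\in V_*$ a cardinal $\mathbf{s}(r)\ge 2$. Then there is a strictly increasing $\omega_1$-sequence $(\mathbf{M}_\gamma)_{\gamma<\omega_1}$ of homogeneous ultrametric spaces, each having spectrum $V$ and degree sequence $\mathbf{s}$ (that is, $\mathrm{Spec}(\mathbf{M}_\gamma)=V$ and $\mathbf{s}_{\mathbf{M}_\gamma}=\mathbf{s}$ for every $\gamma<\omega_1$); strictly increasing means that $\mathbf{M}_\gamma$ is strictly isometrically embeddable into $\mathbf{M}_{\gamma'}$ whenever $\gamma<\gamma'<\omega_1$.
   Context: $\mathbb{R}^+$ and $\mathbb{Q}^+$ denote the non-negative reals and the non-negative rationals (both containing $0$). A metric space $(M,d)$ is ultrametric if $d(x,z)\le\max\{d(x,y),d(y,z)\}$ for all $x,y,z$. It is homogeneous if every isometry between finite subsets extends to a surjective isometry of the whole space. $\mathbf{M}$ is isometrically embeddable into $\mathbf{M}'$ if there is a distance-preserving map from $\mathbf{M}$ into $\mathbf{M}'$; it is strictly isometrically embeddable into $\mathbf{M}'$ if in addition there is no distance-preserving map from $\mathbf{M}'$ into $\mathbf{M}$. For an ultrametric space $\mathbf{M}=(M,d)$: $\mathrm{Spec}(\mathbf{M},a)=\{d(a,x):x\in M\}$ and $\mathrm{Spec}(\mathbf{M})=\{d(x,y):x,y\in M\}$ (the spectrum of $\mathbf{M}$); $\hat B(a,r)=\{x:d(a,x)\le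 r\}$ and $B(a,r)=\{x:d(a,x)<r\}$; the nerve is $\mathrm{Nerv}(\mathbf{M})=\{\hat B(a,r): a\in M, r\in\mathrm{Spec}(\mathbf{M},a)\}$; $\delta(B)$ is the diameter of $B$. For $B\in\mathrm{Nerv}(\mathbf{M})$ with $r=\delta(B)>0$, a son of $B$ is any open ball of radius $r$ (centered at a point of $B$) contained in $B$, and $\mathbf{s}_{\mathbf{M}}(B)$ is the cardinality of the set of sons of $B$. For $r\in\mathrm{Spec}(\mathbf{M})\setminus\{0\}$, $\mathbf{s}_{\mathbf{M}}(r)$ is the supremum of $\mathbf{s}_{\mathbf{M}}(B)$ over all $B\in\mathrm{Nerv}(\mathbf{M})$ of diameter $r$; the function $\mathbf{s}_{\mathbf{M}}$ is the degree sequence of $\mathbf{M}$. *)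

theory Defs
  imports "HOL-Analysis.Analysis"
begin

unbundle cardinal_syntax

text \<open>
  Cardinals are the relations satisfying \<^const>\<open>Card_order\<close>, compared by \<open>\<le>o\<close> and identified up to
  \<open>=o\<close>. As for \<^const>\<open>isCardSuc\<close>, leastness is stated among the cardinals on the same type; lemma
  \<open>card_Sup_least\<close> below extends it to cardinals on an arbitrary type.
\<close>

definition is_card_Sup :: "'a rel set \<Rightarrow> 'a rel \<Rightarrow> bool"
  where "is_card_Sup C \<kappa> \<longleftrightarrow>
    Card_order \<kappa> \<and> (\<forall>c\<in>C. c \<le>o \<kappa>) \<and>
    (\<forall>\<mu>::'a rel. Card_order \<mu> \<and> (\<forall>c\<in>C. c \<le>o \<mu>) \<longrightarrow> \<kappa> \<le>o \<mu>)"

definition card_Sup :: "'a rel set \<Rightarrow> 'a rel"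
  where "card_Sup C = (SOME \<kappa>. is_card_Sup C \<kappa>)"

lemma is_card_Sup_card_Sup:
  assumes "\<forall>c\<in>C. Card_order (c :: 'a rel)"
  shows "is_card_Sup C (card_Sup C)"
proof -
  let ?R = "{\<kappa> :: 'a rel. Card_order \<kappa> \<and> (\<forall>c\<in>C. c \<le>o \<kappa>)}"
  have "c \<le>o |UNIV :: 'a set|" if "c \<in> C" for c
  proof -
    have "|Field c| =o c"
      using assms that by (simp add: card_of_Field_ordIso)
    then show ?thesis
      using card_of_mono1[OF subset_UNIV] ordIso_ordLeq_trans ordIso_symmetric by blast
  qed
  then have "|UNIV :: 'a set| \<in> ?R"
    by (simp add: card_of_Card_order)
  then have "\<exists>\<kappa>\<in>?R. \<forall>\<mu>\<in>?R. \<kappa> \<le>o \<mu>"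
    by (intro exists_minim_Card_order) auto
  then have "\<exists>\<kappa>. is_card_Sup C \<kappa>"
    by (auto simp: is_card_Sup_def)
  then show ?thesis
    unfolding card_Sup_def by (rule someI_ex)
qed

lemma card_Sup_upper:
  assumes "\<forall>c\<in>C. Card_order c" and "c \<in> C"
  shows "c \<le>o card_Sup C"
  using is_card_Sup_card_Sup[OF assms(1)] assms(2) by (simp add: is_card_Sup_def)

lemma card_Sup_least:
  fixes C :: "'a rel set" and \<mu> :: "'b rel"
  assumes C: "\<forall>c\<in>C. Card_order c" and \<mu>: "Card_order \<mu>" and le: "\<forall>c\<in>C. c \<le>o \<mu>"
  shows "card_Sup C \<le>o \<mu>"
proof (rule ccontr)
  let ?S = "card_Sup C"
  have S: "is_card_Sup C ?S"
    by (rule is_card_Sup_card_Sup[OF C])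
  then have co: "Card_order ?S"
    by (simp add: is_card_Sup_def)
  assume n: "\<not> ?S \<le>o \<mu>"
  then have lt: "\<mu> <o ?S"
    using co \<mu> not_ordLeq_iff_ordLess by (auto simp: card_order_on_def)
  then have "|Field \<mu>| \<le>o |Field ?S|"
    using card_of_mono2 ordLess_imp_ordLeq by blast
  then obtain f where f: "inj_on f (Field \<mu>)" "f ` Field \<mu> \<subseteq> Field ?S"
    by (auto simp: card_of_ordLeq[symmetric])
  let ?\<nu> = "|f ` Field \<mu>|"
  have "|Field \<mu>| =o ?\<nu>"
    using f(1) by (intro card_of_ordIsoI) (auto simp: bij_betw_def)
  then have iso: "\<mu> =o ?\<nu>"
    using card_of_Field_ordIso[OF \<mu>] ordIso_symmetric ordIso_transitive by blast
  have "\<forall>c\<in>C. c \<le>o ?\<nu>"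
    using le iso ordLeq_ordIso_trans by blast
  then have "?S \<le>o ?\<nu>"
    using S by (simp add: is_card_Sup_def card_of_Card_order)
  then have "?S \<le>o \<mu>"
    using iso ordIso_symmetric ordLeq_ordIso_trans by blast
  then show False
    using n by simp
qed

definition ultrametric :: "'a metric \<Rightarrow> bool"
  where "ultrametric m \<longleftrightarrow>
    (\<forall>x\<in>mspace m. \<forall>y\<in>mspace m. \<forall>z\<in>mspace m.
       mdist m x z \<le> max (mdist m x y) (mdist m y z))"

definition distance_preserving_on :: "'a set \<Rightarrow> 'a metric \<Rightarrow> 'b metric \<Rightarrow> ('a \<Rightarrow> 'b) \<Rightarrow> bool"
  where "distance_preserving_on A m m' f \<longleftrightarrow>
    (\<forall>x\<in>A. \<forall>y\<in>A. mdist m' (f x) (f y) = mdist m x y)"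

definition homogeneous :: "'a metric \<Rightarrow> bool"
  where "homogeneous m \<longleftrightarrow>
    (\<forall>A B f. finite A \<and> finite B \<and> A \<subseteq> mspace m \<and> B \<subseteq> mspace m \<and>
       f ` A = B \<and> distance_preserving_on A m m f \<longrightarrow>
       (\<exists>g. g ` mspace m = mspace m \<and> distance_preserving_on (mspace m) m m g \<and>
            (\<forall>x\<in>A. g x = f x)))"

definition isometrically_embeddable :: "'a metric \<Rightarrow> 'b metric \<Rightarrow> bool"
  where "isometrically_embeddable m m' \<longleftrightarrow>
    (\<exists>f. f ` mspace m \<subseteq> mspace m' \<and> distance_preserving_on (mspace m) m m' f)"

definition strictly_isometrically_embeddable :: "'a metric \<Rightarrow> 'b metric \<Rightarrow> bool"
  where "strictly_isometrically_embeddable m m' \<longleftrightarrow>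
    isometrically_embeddable m m' \<and> \<not> isometrically_embeddable m' m"

definition Spec_at :: "'a metric \<Rightarrow> 'a \<Rightarrow> real set"
  where "Spec_at m a = {mdist m a x |x. x \<in> mspace m}"

definition Spec :: "'a metric \<Rightarrow> real set"
  where "Spec m = {mdist m x y |x y. x \<in> mspace m \<and> y \<in> mspace m}"

definition Nerv :: "'a metric \<Rightarrow> 'a set set"
  where "Nerv m = {mcball_of m a r |a r. a \<in> mspace m \<and> r \<in> Spec_at m a}"

text \<open>The supremum is taken in the reals, so this is meaningful for bounded nonempty sets only;
  members of the nerve are such sets.\<close>

definition mdiameter :: "'a metric \<Rightarrow> 'a set \<Rightarrow> real"
  where "mdiameter m B = Sup {mdist m x y |x y. x \<in> B \<and> y \<in> B}"

definition sons :: "'a metric \<Rightarrow> 'a set \<Rightarrow> 'a set set"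
  where "sons m B = {mball_of m a (mdiameter m B) |a. a \<in> B \<and> mball_of m a (mdiameter m B) \<subseteq> B}"

definition degree_sequence :: "'a metric \<Rightarrow> real \<Rightarrow> 'a set rel"
  where "degree_sequence m r = card_Sup {|sons m B| |B. B \<in> Nerv m \<and> mdiameter m B = r}"

text \<open>A well-order of type \<open>\<omega>\<^sub>1\<close>; its field plays the role of the set of countable ordinals.\<close>

definition omega_1 :: "nat set rel"
  where "omega_1 = cardSuc natLeq"

end

theory Submission
  imports Defs
begin

text \<open>
  For an ideal \<open>I\<close> of subsets of \<open>V\<^sub>*\<close> whose members have only finitely many elements above each
  positive real, take the functions whose support lies in \<open>I\<close>; two of them are at distance \<open>r\<close> when
  \<open>r\<close> is the largest argument where they differ. Exchanging two open balls by means of a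
  coordinatewise transposition shows that this space is homogeneous. If the space of \<open>J\<close> embeds into
  that of \<open>I\<close>, then every decreasing sequence whose range \<open>D\<close> is in \<open>J\<close> has its range in \<open>I\<close>: the
  values of a preimage are chosen one after the other along the sequence so that the image differs
  from the base point at every element of \<open>D\<close>. So a strictly increasing chain of ideals suffices,
  and one is obtained from an almost disjoint family of sequences of rationals converging to 0,
  indexed by all sets of natural numbers.
\<close>

section \<open>The distance\<close>

text \<open>The absolute value only serves to make the junk value for unbounded sets nonnegative.\<close>

definition diff_dist :: "(real \<Rightarrow> 'k) \<Rightarrow> (real \<Rightarrow> 'k) \<Rightarrow> real"
  where "diff_dist f g = \<bar>Sup (insert 0 {t. f t \<noteq> g t})\<bar>"

lemma diff_dist_nonneg: "0 \<le> diff_dist f g"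
  by (simp add: diff_dist_def)

lemma diff_dist_commute: "diff_dist f g = diff_dist g f"
proof -
  have "{t. f t \<noteq> g t} = {t. g t \<noteq> f t}"
    by auto
  then show ?thesis
    by (simp add: diff_dist_def)
qed

text \<open>Here \<open>V\<close> is the intended spectrum without 0. The values allowed at
  \<open>t\<close> form \<open>K t\<close>, whose cardinality becomes the degree at
  \<open>t\<close>; \<open>ex_other\<close> is thus the requirement that degrees are at least 2.
  Local finiteness turns suprema of difference sets into maxima, and \<open>ideal_finite\<close>
  lets every element of \<open>V\<close> occur as a distance.\<close>

locale ideal_space =
  fixes V :: "real set" and I :: "real set set" and K :: "real \<Rightarrow> 'k set" and e :: "real \<Rightarrow> 'k"
  assumes V_pos: "V \<subseteq> {0<..}"
    and ideal_sub: "X \<in> I \<Longrightarrow> X \<subseteq> V"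
    and ideal_locally_finite: "X \<in> I \<Longrightarrow> 0 < r \<Longrightarrow> finite (X \<inter> {r..})"
    and ideal_mono: "X \<in> I \<Longrightarrow> Y \<subseteq> X \<Longrightarrow> Y \<in> I"
    and ideal_Un: "X \<in> I \<Longrightarrow> Y \<in> I \<Longrightarrow> X \<union> Y \<in> I"
    and ideal_finite: "X \<subseteq> V \<Longrightarrow> finite X \<Longrightarrow> X \<in> I"
    and base_in: "t \<in> V \<Longrightarrow> e t \<in> K t"
    and ex_other: "t \<in> V \<Longrightarrow> \<exists>a\<in>K t. a \<noteq> e t"
begin

text \<open>Membership in \<open>K t\<close> is asked only off the base point, since
  \<open>e t\<close> need not lie in \<open>K t\<close> for \<open>t\<close> outside
  \<open>V\<close>. As supports are subsets of \<open>V\<close>, all points agree with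
  \<open>e\<close> there.\<close>

definition points :: "(real \<Rightarrow> 'k) set"
  where "points = {f. (\<forall>t. f t \<noteq> e t \<longrightarrow> f t \<in> K t) \<and> {t. f t \<noteq> e t} \<in> I}"

definition space :: "(real \<Rightarrow> 'k) metric"
  where "space = metric (points, diff_dist)"

lemma base_point: "e \<in> points"
  by (simp add: points_def ideal_finite)

lemma points_val: "f \<in> points \<Longrightarrow> t \<in> V \<Longrightarrow> f t \<in> K t"
  using base_in by (cases "f t = e t") (auto simp: points_def)

lemma points_upd:
  assumes "f \<in> points" "t \<in> V" "a \<in> K t"
  shows "f(t := a) \<in> points"
proof -
  have "{t. f t \<noteq> e t} \<union> {t} \<in> I"
    using assms by (intro ideal_Un ideal_finite[of "{t}"]) (auto simp: points_def)
  then have "{u. (f(t := a)) u \<noteq> e u} \<in> I"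
    by (rule ideal_mono) auto
  then show ?thesis
    using assms by (auto simp: points_def)
qed

text \<open>Where two points differ, at least one differs from \<open>e\<close>. Thus local
  finiteness applies to difference sets.\<close>

lemma diff_set_in_ideal:
  assumes "f \<in> points" "g \<in> points"
  shows "{t. f t \<noteq> g t} \<in> I"
proof -
  have "{t. f t \<noteq> e t} \<union> {t. g t \<noteq> e t} \<in> I"
    using assms by (intro ideal_Un) (auto simp: points_def)
  then show ?thesis
    by (rule ideal_mono) auto
qed

lemma diff_pos: "f \<in> points \<Longrightarrow> g \<in> points \<Longrightarrow> f t \<noteq> g t \<Longrightarrow> t \<in> V \<and> 0 < t"
  using ideal_sub[OF diff_set_in_ideal[of f g]] V_pos by auto

lemma bdd_above_diff:
  assumes "f \<in> points" "g \<in> points"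
  shows "bdd_above (insert 0 {t. f t \<noteq> g t})"
proof -
  have "finite ({t. f t \<noteq> g t} \<inter> {1..})"
    by (intro ideal_locally_finite diff_set_in_ideal assms) simp
  then have "bdd_above ({t. f t \<noteq> g t} \<inter> {1..})"
    by (rule bdd_above_finite)
  then have "bdd_above ({t. f t \<noteq> g t} \<inter> {1..} \<union> insert 0 {..1})"
    by simp
  then show ?thesis
    by (rule bdd_above_mono) auto
qed

lemma diff_dist_eq_Sup:
  assumes "f \<in> points" "g \<in> points"
  shows "diff_dist f g = Sup (insert 0 {t. f t \<noteq> g t})"
  using cSup_upper[OF _ bdd_above_diff[OF assms], of 0] by (simp add: diff_dist_def)

lemma diff_dist_le_iff:
  assumes "f \<in> points" "g \<in> points" "0 \<le> r"
  shows "diff_dist f g \<le> r \<longleftrightarrow> (\<forall>t>r. f t = g t)"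
  unfolding diff_dist_eq_Sup[OF assms(1,2)]
  using cSup_le_iff[OF _ bdd_above_diff[OF assms(1,2)], of r] assms(3)
  by (auto simp: not_le)

text \<open>The strict bound rests on local finiteness: only finitely many differences lie above
  \<open>r/2\<close>, so agreement from \<open>r\<close> on leaves a bound strictly below
  \<open>r\<close>.\<close>

lemma diff_dist_less_iff:
  assumes "f \<in> points" "g \<in> points" "0 < r"
  shows "diff_dist f g < r \<longleftrightarrow> (\<forall>t\<ge>r. f t = g t)"
proof
  assume less: "diff_dist f g < r"
  show "\<forall>t\<ge>r. f t = g t"
    using diff_dist_le_iff[OF assms(1,2) diff_dist_nonneg, of f g] less by auto
next
  assume eq: "\<forall>t\<ge>r. f t = g t"
  have fin: "finite ({t. f t \<noteq> g t} \<inter> {r/2..})"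
    by (intro ideal_locally_finite diff_set_in_ideal assms) (use assms in simp)
  \<comment> \<open>Inserting \<open>r/2\<close> makes the set nonempty and keeps the bound
    nonnegative, while the bound still bounds the differences below \<open>r/2\<close>.\<close>
  let ?m = "Max (insert (r/2) ({t. f t \<noteq> g t} \<inter> {r/2..}))"
  have "r/2 \<le> ?m"
    using fin by (intro Max_ge) auto
  then have "0 \<le> ?m"
    using assms(3) by simp
  moreover have "\<forall>t>?m. f t = g t"
  proof (intro allI impI)
    fix t assume t: "?m < t"
    with \<open>r/2 \<le> ?m\<close> have "r/2 \<le> t"
      by simp
    show "f t = g t"
    proof (rule ccontr)
      assume "f t \<noteq> g t"
      then have "t \<le> ?m"
        using fin \<open>r/2 \<le> t\<close> by (intro Max_ge) auto
      with t show False
        by simp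
    qed
  qed
  ultimately have "diff_dist f g \<le> ?m"
    using diff_dist_le_iff[OF assms(1,2)] by blast
  also have "?m < r"
    using fin eq assms(3) by (subst Max_less_iff) (auto simp: not_le[symmetric])
  finally show "diff_dist f g < r" .
qed

lemma diff_dist_ultra:
  assumes "f \<in> points" "g \<in> points" "h \<in> points"
  shows "diff_dist f h \<le> max (diff_dist f g) (diff_dist g h)"
proof -
  have "\<forall>t>diff_dist f g. f t = g t" "\<forall>t>diff_dist g h. g t = h t"
    using diff_dist_le_iff[OF _ _ diff_dist_nonneg] assms by blast+
  then show ?thesis
    using assms by (subst diff_dist_le_iff) (auto simp: diff_dist_nonneg le_max_iff_disj)
qed

lemma diff_dist_eq_0_iff:
  assumes "f \<in> points" "g \<in> points"
  shows "diff_dist f g = 0 \<longleftrightarrow> f = g"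
proof -
  have "diff_dist f g = 0 \<longleftrightarrow> (\<forall>t>0. f t = g t)"
    using diff_dist_le_iff[OF assms, of 0] diff_dist_nonneg[of f g] by auto
  then show ?thesis
    using diff_pos[OF assms] by blast
qed

text \<open>The supremum is a maximum: the characterisations of \<open><\<close> and
  \<open>\<le>\<close> differ only in the coordinate \<open>r\<close> itself.\<close>

lemma diff_dist_attained:
  assumes "f \<in> points" "g \<in> points" "diff_dist f g = r" "0 < r"
  shows "f r \<noteq> g r"
proof -
  have "\<not> diff_dist f g < r" "diff_dist f g \<le> r"
    using assms by simp_all
  then show ?thesis
    using assms(4) unfolding diff_dist_less_iff[OF assms(1,2,4)] diff_dist_le_iff[OF assms(1,2) less_imp_le[OF assms(4)]]
    by (metis order_le_less)
qed

lemma diff_dist_eqI: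
  assumes "f \<in> points" "g \<in> points" "f r \<noteq> g r" "\<And>t. r < t \<Longrightarrow> f t = g t"
  shows "diff_dist f g = r"
proof -
  have "0 < r"
    using diff_pos assms by blast
  then have "diff_dist f g \<le> r" "\<not> diff_dist f g < r"
    using diff_dist_le_iff[of f g r] diff_dist_less_iff[of f g r] assms by auto
  then show ?thesis
    by simp
qed

lemma diff_dist_upd:
  assumes "f \<in> points" "r \<in> V" "a \<in> K r" "a \<noteq> f r"
  shows "diff_dist f (f(r := a)) = r"
  using assms points_upd[OF assms(1-3)] by (intro diff_dist_eqI) simp_all

lemma Metric_space_points: "Metric_space points diff_dist"
proof
  fix f g h assume *: "f \<in> points" "g \<in> points" "h \<in> points"
  show "diff_dist f h \<le> diff_dist f g + diff_dist g h"
    using diff_dist_ultra[OF *] diff_dist_nonneg[of f g] diff_dist_nonneg[of g h] by linarith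
qed (fact diff_dist_nonneg diff_dist_commute diff_dist_eq_0_iff)+

lemma mspace_space [simp]: "mspace space = points"
  unfolding space_def by (rule Metric_space.mspace_metric[OF Metric_space_points])

lemma mdist_space [simp]: "mdist space = diff_dist"
  unfolding space_def by (rule Metric_space.mdist_metric[OF Metric_space_points])

lemma ultrametric_space: "ultrametric space"
  by (simp add: ultrametric_def diff_dist_ultra)

lemma diff_dist_in:
  assumes "f \<in> points" "g \<in> points"
  shows "diff_dist f g \<in> insert 0 V"
proof (cases "diff_dist f g = 0")
  case False
  then have "0 < diff_dist f g"
    using diff_dist_nonneg[of f g] by simp
  then show ?thesis
    using diff_dist_attained[OF assms refl] diff_pos[OF assms] by simp
qed simp

lemma ex_dist:
  assumes "f \<in> points" "r \<in> V"
  shows "\<exists>g\<in>points. diff_dist f g = r"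
proof -
  obtain a where "a \<in> K r" "a \<noteq> f r"
    using ex_other[OF assms(2)] base_in[OF assms(2)] by (cases "f r = e r") auto
  then show ?thesis
    using diff_dist_upd[OF assms] points_upd[OF assms] by blast
qed

lemma Spec_space: "Spec space = insert 0 V"
proof
  show "Spec space \<subseteq> insert 0 V"
    unfolding Spec_def mspace_space mdist_space using diff_dist_in by blast
  have "diff_dist e e = 0"
    using diff_dist_eq_0_iff base_point by blast
  moreover have "diff_dist f g \<in> Spec space" if "f \<in> points" "g \<in> points" for f g
    using that by (auto simp: Spec_def)
  ultimately show "insert 0 V \<subseteq> Spec space"
    using ex_dist[OF base_point] base_point by (metis insert_iff subsetI)
qed

section \<open>Degree sequence\<close>

lemma mcball_space: "f \<in> points \<Longrightarrow> mcball_of space f r = {g \<in> points. diff_dist f g \<le> r}"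
  by (auto simp: mcball_of_def Metric_space.mcball_def[OF Metric_space_points])

lemma mball_space: "f \<in> points \<Longrightarrow> mball_of space f r = {g \<in> points. diff_dist f g < r}"
  by (auto simp: mball_of_def Metric_space.mball_def[OF Metric_space_points])

text \<open>The radius is attained as a distance from the centre, and the ultrametric inequality
  keeps any two points of the ball within it.\<close>

lemma mdiameter_mcball:
  assumes "f \<in> points" "r \<in> Spec_at space f"
  shows "mdiameter space (mcball_of space f r) = r"
proof -
  obtain g where g: "g \<in> points" "diff_dist f g = r"
    using assms by (auto simp: Spec_at_def)
  have r: "0 \<le> r"
    using g diff_dist_nonneg by metis
  have ff: "diff_dist f f \<le> r"
    using diff_dist_eq_0_iff[OF assms(1) assms(1)] r by simp
  show ?thesis
    unfolding mdiameter_def mcball_space[OF assms(1)]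
  proof (rule cSup_eq_maximum)
    show "r \<in> {mdist space x y |x y. x \<in> {g \<in> points. diff_dist f g \<le> r} \<and> y \<in> {g \<in> points. diff_dist f g \<le> r}}"
      using g assms(1) ff by auto
  next
    fix t assume "t \<in> {mdist space x y |x y. x \<in> {g \<in> points. diff_dist f g \<le> r} \<and> y \<in> {g \<in> points. diff_dist f g \<le> r}}"
    then obtain x y where xy: "x \<in> points" "y \<in> points" "diff_dist f x \<le> r" "diff_dist f y \<le> r" "t = diff_dist x y"
      by auto
    then show "t \<le> r"
      using diff_dist_ultra[of x f y] assms(1) diff_dist_commute[of x f] by linarith
  qed
qed

text \<open>Points of the closed ball agree with \<open>f\<close> above \<open>r\<close>, and an
  open ball of radius \<open>r\<close> fixes exactly the coordinates from \<open>r\<close> on. So a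
  son is determined by its value at \<open>r\<close>, which ranges over \<open>K r\<close>.\<close>

lemma card_sons_mcball:
  assumes f: "f \<in> points" and r: "r \<in> V" and spec: "r \<in> Spec_at space f"
  shows "|sons space (mcball_of space f r)| =o |K r|"
proof -
  let ?B = "mcball_of space f r" and ?son = "\<lambda>k. mball_of space (f(r := k)) r"
  have r0: "0 < r"
    using r V_pos by auto
  have ball: "mball_of space g r = {h \<in> points. \<forall>t\<ge>r. g t = h t}" if "g \<in> points" for g
    using that diff_dist_less_iff r0 by (auto simp: mball_space)
  have cball: "?B = {g \<in> points. \<forall>t>r. f t = g t}"
    using f diff_dist_le_iff r0 by (auto simp: mcball_space)
  have "inj_on ?son (K r)"
  proof (rule inj_onI)
    fix k l assume kl: "k \<in> K r" "l \<in> K r" "?son k = ?son l"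
    then have "f(r := k) \<in> ?son l"
      using ball[of "f(r := k)"] points_upd[OF f r] by auto
    then show "k = l"
      using kl ball[of "f(r := l)"] points_upd[OF f r] by auto
  qed
  moreover have "sons space ?B = ?son ` K r"
  proof -
    have "sons space ?B = {mball_of space g r |g. g \<in> ?B \<and> mball_of space g r \<subseteq> ?B}"
      by (simp add: sons_def mdiameter_mcball[OF f spec])
    also have "\<dots> = ?son ` K r"
    proof safe
      fix g assume g: "g \<in> ?B"
      then have "mball_of space g r = ?son (g r)"
        using ball[of g] ball[of "f(r := g r)"] points_upd[OF f r] points_val[OF _ r]
        by (auto simp: cball)
      then show "mball_of space g r \<in> ?son ` K r"
        using g points_val r by (auto simp: cball)
    next
      fix k assume k: "k \<in> K r"
      then have "f(r := k) \<in> ?B" "?son k \<subseteq> ?B"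
        using ball[of "f(r := k)"] points_upd[OF f r] by (auto simp: cball)
      then show "\<exists>g. ?son k = mball_of space g r \<and> g \<in> ?B \<and> mball_of space g r \<subseteq> ?B"
        by blast
    qed
    finally show ?thesis .
  qed
  ultimately have "bij_betw ?son (K r) (sons space ?B)"
    by (simp add: bij_betw_def)
  then show ?thesis
    using card_of_ordIsoI ordIso_symmetric by blast
qed

text \<open>The supremum is over a nonempty family of cardinals all equal to that of
  \<open>K r\<close>. The bound from above compares cardinals on different types, hence
  \<open>card_Sup_least\<close>.\<close>

lemma degree_sequence_space:
  assumes r: "r \<in> V"
  shows "degree_sequence space r =o |K r|"
proof -
  let ?C = "{|sons space B| |B. B \<in> Nerv space \<and> mdiameter space B = r}"
  have card: "\<forall>c\<in>?C. Card_order c"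
    by (auto simp: card_of_Card_order)
  have iso: "c =o |K r|" if "c \<in> ?C" for c :: "(real \<Rightarrow> 'k) set rel"
  proof -
    from that obtain f \<rho> where *: "c = |sons space (mcball_of space f \<rho>)|" "f \<in> points"
      "\<rho> \<in> Spec_at space f" "mdiameter space (mcball_of space f \<rho>) = r"
      by (auto simp: Nerv_def)
    then show ?thesis
      using mdiameter_mcball card_sons_mcball r by metis
  qed
  have spec: "r \<in> Spec_at space e"
    using ex_dist[OF base_point r] by (auto simp: Spec_at_def)
  have mem: "|sons space (mcball_of space e r)| \<in> ?C"
    using base_point spec mdiameter_mcball[OF base_point spec] by (force simp: Nerv_def)
  have "|K r| \<le>o card_Sup ?C"
    using card_Sup_upper[OF card mem] iso[OF mem] ordIso_symmetric ordIso_ordLeq_trans by blast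
  moreover have "card_Sup ?C \<le>o |K r|"
    using iso ordIso_imp_ordLeq by (intro card_Sup_least[OF card]) (blast intro: card_of_Card_order)+
  ultimately show ?thesis
    by (simp add: degree_sequence_def ordIso_iff_ordLeq)
qed

section \<open>Homogeneity\<close>

text \<open>Every coordinate is permuted by a bijection, so difference sets are preserved.
  Coordinates where \<open>x\<close> and \<open>y\<close> agree are left alone.\<close>

definition swap_coords :: "(real \<Rightarrow> 'k) \<Rightarrow> (real \<Rightarrow> 'k) \<Rightarrow> (real \<Rightarrow> 'k) \<Rightarrow> real \<Rightarrow> 'k"
  where "swap_coords x y z t = Transposition.transpose (x t) (y t) (z t)"

lemma swap_coords_simps [simp]:
  "swap_coords x y x = y" "swap_coords x y y = x" "swap_coords x y (swap_coords x y z) = z"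
  by (auto simp: swap_coords_def)

lemma swap_coords_eq_iff [simp]: "swap_coords x y z t = swap_coords x y w t \<longleftrightarrow> z t = w t"
  unfolding swap_coords_def by (metis transpose_involutory)

lemma diff_dist_swap [simp]: "diff_dist (swap_coords x y z) (swap_coords x y w) = diff_dist z w"
  by (simp add: diff_dist_def)

lemma swap_coords_points:
  assumes "x \<in> points" "y \<in> points" "z \<in> points"
  shows "swap_coords x y z \<in> points"
proof -
  have sub: "swap_coords x y z t \<in> {x t, y t, z t}" for t
    by (auto simp: swap_coords_def Transposition.transpose_def)
  have "({t. x t \<noteq> e t} \<union> {t. y t \<noteq> e t}) \<union> {t. z t \<noteq> e t} \<in> I"
    using assms by (intro ideal_Un) (auto simp: points_def)
  then have "{t. swap_coords x y z t \<noteq> e t} \<in> I"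
  proof (rule ideal_mono)
    show "{t. swap_coords x y z t \<noteq> e t} \<subseteq> {t. x t \<noteq> e t} \<union> {t. y t \<noteq> e t} \<union> {t. z t \<noteq> e t}"
    proof
      fix t assume "t \<in> {t. swap_coords x y z t \<noteq> e t}"
      then show "t \<in> {t. x t \<noteq> e t} \<union> {t. y t \<noteq> e t} \<union> {t. z t \<noteq> e t}"
        using sub[of t] by auto
    qed
  qed
  moreover have "swap_coords x y z t \<in> K t" if "swap_coords x y z t \<noteq> e t" for t
    using sub[of t] that assms by (auto simp: points_def)
  ultimately show ?thesis
    by (simp add: points_def)
qed

text \<open>The full \<open>swap_coords x y\<close> is already an isometry exchanging
  \<open>x\<close> and \<open>y\<close>. Restricting it to the open balls of radius
  \<open>diff_dist x y\<close> around them fixes all other points, as the extension argument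
  requires. For \<open>x = y\<close> both balls are empty and the map is the identity.\<close>

definition ball_swap :: "(real \<Rightarrow> 'k) \<Rightarrow> (real \<Rightarrow> 'k) \<Rightarrow> (real \<Rightarrow> 'k) \<Rightarrow> real \<Rightarrow> 'k"
  where "ball_swap x y z =
    (if diff_dist x z < diff_dist x y \<or> diff_dist y z < diff_dist x y then swap_coords x y z else z)"

lemma swap_coords_dists:
  "diff_dist x (swap_coords x y z) = diff_dist y z" "diff_dist y (swap_coords x y z) = diff_dist x z"
  using diff_dist_swap[of x y y z] diff_dist_swap[of x y x z] by simp_all

text \<open>The swap exchanges the distances to \<open>x\<close> and to \<open>y\<close>, so the
  condition in the definition is invariant under it.\<close>

lemma ball_swap_involutory: "ball_swap x y (ball_swap x y z) = z"
  by (auto simp: ball_swap_def swap_coords_dists)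

lemma ball_swap_points: "x \<in> points \<Longrightarrow> y \<in> points \<Longrightarrow> z \<in> points \<Longrightarrow> ball_swap x y z \<in> points"
  by (simp add: ball_swap_def swap_coords_points)

text \<open>A point in neither ball is as far from the points of the one ball as from those of the other.\<close>

lemma diff_dist_outside:
  assumes pts: "x \<in> points" "y \<in> points" "z \<in> points" "w \<in> points"
    and z: "diff_dist x z < diff_dist x y \<or> diff_dist y z < diff_dist x y"
    and w: "\<not> (diff_dist x w < diff_dist x y \<or> diff_dist y w < diff_dist x y)"
  shows "diff_dist (swap_coords x y z) w = diff_dist z w"
proof -
  let ?z = "swap_coords x y z" and ?r = "diff_dist x y"
  have z': "diff_dist x ?z < ?r \<or> diff_dist y ?z < ?r" "?z \<in> points"
    using z pts by (auto simp: swap_coords_dists swap_coords_points)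
  have far: "?r \<le> diff_dist u w" if "u \<in> points" "diff_dist x u < ?r \<or> diff_dist y u < ?r" for u
    using that w diff_dist_ultra[of x u w] diff_dist_ultra[of y u w] pts by auto
  have near: "diff_dist x u \<le> ?r" if "u \<in> points" "diff_dist x u < ?r \<or> diff_dist y u < ?r" for u
    using that diff_dist_ultra[of x y u] pts by auto
  have "diff_dist z ?z \<le> max (diff_dist x z) (diff_dist x ?z)"
    using diff_dist_ultra[of z x ?z] pts z' by (simp add: diff_dist_commute)
  also have "\<dots> \<le> ?r"
    using near[of z] near[of ?z] pts z z' by simp
  finally have close: "diff_dist z ?z \<le> ?r" .
  \<comment> \<open>Both \<open>z\<close> and its image are at least \<open>?r\<close> from
    \<open>w\<close> and at most \<open>?r\<close> from each other, so the ultrametric inequality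
    makes their distances to \<open>w\<close> equal.\<close>
  have "?r \<le> diff_dist z w" "?r \<le> diff_dist ?z w"
    using far z z' pts by blast+
  moreover have "diff_dist z w \<le> max (diff_dist z ?z) (diff_dist ?z w)"
    "diff_dist ?z w \<le> max (diff_dist z ?z) (diff_dist z w)"
    using diff_dist_ultra[of z ?z w] diff_dist_ultra[of ?z z w] pts z'
    by (simp_all add: diff_dist_commute[of ?z z])
  ultimately show ?thesis
    using close by auto
qed

lemma diff_dist_ball_swap:
  assumes "x \<in> points" "y \<in> points" "z \<in> points" "w \<in> points"
  shows "diff_dist (ball_swap x y z) (ball_swap x y w) = diff_dist z w"
  using diff_dist_outside[of x y z w] diff_dist_outside[of x y w z] assms
    diff_dist_commute[of z "swap_coords x y w"] diff_dist_commute[of z w]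
  by (auto simp: ball_swap_def)

text \<open>By induction on \<open>A\<close>: an extension \<open>g\<close> for the old points is
  corrected at the new point \<open>a\<close> by composing it with the exchange of balls around
  \<open>g a\<close> and \<open>f a\<close>.\<close>

lemma extend_partial_isometry:
  assumes "finite A" "A \<subseteq> points" "f ` A \<subseteq> points" "distance_preserving_on A space space f"
  shows "\<exists>g. g ` points = points \<and> distance_preserving_on points space space g \<and> (\<forall>x\<in>A. g x = f x)"
  using assms
proof (induction A rule: finite_induct)
  case empty
  show ?case
    by (rule exI[of _ id]) (simp add: distance_preserving_on_def)
next
  case (insert a A)
  then obtain g where g: "g ` points = points" "distance_preserving_on points space space g" "\<forall>x\<in>A. g x = f x"
    by (auto simp: distance_preserving_on_def)
  let ?h = "ball_swap (g a) (f a)"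
  have pts: "g a \<in> points" "f a \<in> points"
    using insert.prems g(1) by auto
  have "?h ` points = points"
    using ball_swap_points[OF pts] ball_swap_involutory[of "g a" "f a"]
    by (metis (no_types, opaque_lifting) image_iff subsetI subset_antisym)
  then have "(?h \<circ> g) ` points = points"
    by (simp only: image_comp[symmetric] g(1))
  moreover have "distance_preserving_on points space space (?h \<circ> g)"
  proof -
    have "g x \<in> points" if "x \<in> points" for x
      using g(1) that by blast
    then show ?thesis
      using g(2) diff_dist_ball_swap[OF pts] by (simp add: distance_preserving_on_def)
  qed
  moreover have "(?h \<circ> g) a = f a"
    using pts diff_dist_eq_0_iff[OF pts] diff_dist_eq_0_iff[of "g a" "g a"] diff_dist_nonneg[of "g a" "f a"]
    by (auto simp: ball_swap_def)
  moreover have "(?h \<circ> g) x = f x" if x: "x \<in> A" for x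
  proof -
    have x': "x \<in> points" "a \<in> points" "f x \<in> points" "g x = f x"
      using insert.prems g(3) x by auto
    have "diff_dist (g a) (f x) = diff_dist a x"
      using g(2) x' by (simp add: distance_preserving_on_def) metis
    also have "\<dots> = diff_dist (f a) (f x)"
      using insert.prems x by (simp add: distance_preserving_on_def)
    \<comment> \<open>Being equally far from \<open>g a\<close> and \<open>f a\<close>, the point
      \<open>f x\<close> cannot be closer to them than they are to each other. So it lies in neither
      ball and stays fixed.\<close>
    finally have "\<not> diff_dist (g a) (f x) < diff_dist (g a) (f a)" "\<not> diff_dist (f a) (f x) < diff_dist (g a) (f a)"
      using diff_dist_ultra[of "g a" "f x" "f a"] pts x' diff_dist_commute[of "f x" "f a"] by auto
    then show ?thesis
      using x' by (simp add: ball_swap_def)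
  qed
  ultimately show ?case
    by (intro exI[of _ "?h \<circ> g"]) (simp del: o_apply)
qed

lemma homogeneous_space: "homogeneous space"
  unfolding homogeneous_def using extend_partial_isometry by (metis mspace_space)

end

section \<open>Embeddings\<close>

lemma embeddable_mono:
  assumes "ideal_space V I K e" "ideal_space V J K e" "I \<subseteq> J"
  shows "isometrically_embeddable (ideal_space.space I K e) (ideal_space.space J K e)"
proof -
  interpret I: ideal_space V I K e by fact
  interpret J: ideal_space V J K e by fact
  have "I.points \<subseteq> J.points"
    using assms(3) by (auto simp: I.points_def J.points_def)
  then show ?thesis
    unfolding isometrically_embeddable_def distance_preserving_on_def
    by (intro exI[of _ id]) auto
qed

text \<open>A point of the space of \<open>J\<close> is built whose image has support containing
  \<open>range d\<close>; since that support is in \<open>I\<close>, so is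
  \<open>range d\<close>.\<close>

lemma decreasing_sequence_in_ideal:
  assumes "ideal_space V I K e" "ideal_space V J K e"
    and emb: "isometrically_embeddable (ideal_space.space J K e) (ideal_space.space I K e)"
    and dec: "\<And>m n :: nat. m < n \<Longrightarrow> d n < d m" and D: "range d \<in> J"
  shows "range d \<in> I"
proof -
  interpret I: ideal_space V I K e by fact
  interpret J: ideal_space V J K e by fact
  obtain \<phi> where \<phi>: "\<And>x. x \<in> J.points \<Longrightarrow> \<phi> x \<in> I.points"
    and iso: "\<And>x y. x \<in> J.points \<Longrightarrow> y \<in> J.points \<Longrightarrow> diff_dist (\<phi> x) (\<phi> y) = diff_dist x y"
    using emb unfolding isometrically_embeddable_def distance_preserving_on_def
      I.mspace_space J.mspace_space I.mdist_space J.mdist_space by blast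
  have dV: "d n \<in> V" "0 < d n" for n
    using J.ideal_sub[OF D] J.V_pos by auto
  obtain a where a: "\<And>t. t \<in> V \<Longrightarrow> a t \<in> K t \<and> a t \<noteq> e t"
    using J.ex_other by metis
  \<comment> \<open>Stage \<open>n\<close> changes the value at \<open>d n\<close> only if the image
    of the current point still has the base value there.\<close>
  define F where "F = rec_nat e (\<lambda>n f. if \<phi> f (d n) \<noteq> e (d n) then f else f(d n := a (d n)))"
  have F0: "F 0 = e"
    and FS: "F (Suc n) = (if \<phi> (F n) (d n) \<noteq> e (d n) then F n else (F n)(d n := a (d n)))" for n
    by (simp_all add: F_def)
  have F_pts: "F n \<in> J.points" for n
    by (induction n) (simp_all add: F0 FS J.base_point J.points_upd a dV)
  have F_val: "F n t \<in> {e t, a t}" for n t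
    by (induction n) (auto simp: F0 FS)
  have F_fresh: "m \<le> n \<Longrightarrow> F m (d n) = e (d n)" for m n
  proof (induction m)
    case (Suc m)
    then show ?case
      using dec[of m n] by (auto simp: FS)
  qed (simp add: F0)
  have F_stable: "Suc n \<le> m \<Longrightarrow> d n \<le> t \<Longrightarrow> F m t = F (Suc n) t" for m n t
  proof (induction m rule: dec_induct)
    case (step m)
    then show ?case
      using dec[of n m] by (auto simp: FS[of m])
  qed simp
  have F_off: "t \<notin> range d \<Longrightarrow> F n t = e t" for n t
    by (induction n) (auto simp: F0 FS)
  \<comment> \<open>The limit of the stages: the value at \<open>d n\<close> is settled from stage
    \<open>Suc n\<close> on, as each coordinate is treated only once.\<close>
  define f where "f t = (if t \<in> range d then F (Suc (inv d t)) t else e t)" for t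
  have "inj d"
    by (intro linorder_injI) (metis dec less_irrefl)
  then have f_d: "f (d n) = F (Suc n) (d n)" for n
    by (simp add: f_def)
  have f_pts: "f \<in> J.points"
  proof -
    \<comment> \<open>This is where \<open>range d\<close> being in \<open>J\<close> enters: the
      limit, with possibly infinite support, is still a point.\<close>
    have "{t. f t \<noteq> e t} \<subseteq> range d"
      by (auto simp: f_def)
    moreover have "f t \<in> K t" if "f t \<noteq> e t" for t
      using that F_val[of "Suc (inv d t)" t] a[of t] J.ideal_sub[OF D] by (auto simp: f_def split: if_splits)
    ultimately show ?thesis
      using J.ideal_mono[OF D] by (simp add: J.points_def)
  qed
  have f_eq: "f t = F (Suc n) t" if "d n \<le> t" for n t
  proof (cases "t \<in> range d")
    case True
    then obtain m where m: "t = d m"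
      by auto
    then have "m \<le> n"
      using that dec[of n m] by (meson linorder_not_less)
    then show ?thesis
      using F_stable[of m "Suc n" t] m f_d by simp
  next
    case False
    then show ?thesis
      by (simp add: F_off f_def)
  qed
  have "\<phi> f (d n) \<noteq> e (d n)" for n
  proof -
    \<comment> \<open>Later stages change only coordinates below \<open>d n\<close>, so they cannot
      affect the image at \<open>d n\<close>.\<close>
    have "diff_dist (\<phi> f) (\<phi> (F (Suc n))) < d n"
      unfolding iso[OF f_pts F_pts] J.diff_dist_less_iff[OF f_pts F_pts dV(2)] using f_eq by blast
    then have "\<phi> f (d n) = \<phi> (F (Suc n)) (d n)"
      unfolding I.diff_dist_less_iff[OF \<phi>[OF f_pts] \<phi>[OF F_pts] dV(2)] by blast
    moreover have "\<phi> (F (Suc n)) (d n) \<noteq> e (d n)"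
    proof (cases "\<phi> (F n) (d n) = e (d n)")
      case True
      then have F': "F (Suc n) = (F n)(d n := a (d n))"
        by (simp add: FS)
      \<comment> \<open>The change moves the point by exactly \<open>d n\<close>, so the images
        differ at the coordinate \<open>d n\<close>, and the new image leaves the base
        value.\<close>
      have "diff_dist (F n) (F (Suc n)) = d n"
        unfolding F' using a dV(1) F_fresh[of n n] F_pts by (intro J.diff_dist_upd) auto
      then have "\<phi> (F n) (d n) \<noteq> \<phi> (F (Suc n)) (d n)"
        by (intro I.diff_dist_attained \<phi> F_pts dV(2)) (simp add: iso F_pts)
      with True show ?thesis
        by simp
    qed (simp add: FS)
    ultimately show ?thesis
      by simp
  qed
  then have "range d \<subseteq> {t. \<phi> f t \<noteq> e t}"
    by auto
  moreover have "{t. \<phi> f t \<noteq> e t} \<in> I"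
    using \<phi>[OF f_pts] by (simp add: I.points_def)
  ultimately show ?thesis
    using I.ideal_mono by blast
qed

section \<open>An almost disjoint family of sequences\<close>

text \<open>Being the maximum of the encoded set, \<open>n\<close> can be read off the code.\<close>

definition branch_code :: "nat set \<Rightarrow> nat \<Rightarrow> nat"
  where "branch_code S n = set_encode (insert n (S \<inter> {..<n}))"

definition branch_seq :: "nat set \<Rightarrow> nat \<Rightarrow> real"
  where "branch_seq S n = 1 / (1 + real (branch_code S n))"

lemma branch_code_eq:
  assumes "branch_code S m = branch_code T n"
  shows "m = n \<and> S \<inter> {..<m} = T \<inter> {..<n}"
proof -
  have eq: "insert m (S \<inter> {..<m}) = insert n (T \<inter> {..<n})"
    using assms unfolding branch_code_def by (subst (asm) set_encode_eq) simp_all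
  have "m \<in> insert n (T \<inter> {..<n})" "n \<in> insert m (S \<inter> {..<m})"
    using eq by blast+
  then have "m = n"
    by auto
  with eq show ?thesis
    by (auto simp: set_eq_iff)
qed

text \<open>A set with maximum \<open>n\<close> has code below \<open>2 ^ Suc n\<close>, and the
  next code contains that power as a summand.\<close>

lemma branch_code_less_Suc: "branch_code S n < branch_code S (Suc n)"
proof -
  have "branch_code S n = 2 ^ n + (\<Sum>i\<in>S \<inter> {..<n}. 2 ^ i)"
    by (simp add: branch_code_def set_encode_def)
  also have "(\<Sum>i\<in>S \<inter> {..<n}. 2 ^ i) \<le> (\<Sum>i\<in>{0..<n}. 2 ^ i :: nat)"
    by (intro sum_mono2) auto
  also have "\<dots> < 2 ^ n"
    by (simp add: sum_power2)
  also have "2 ^ n + 2 ^ n \<le> branch_code S (Suc n)"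
    by (simp add: branch_code_def set_encode_def)
  finally show ?thesis
    by simp
qed

lemma branch_seq_decreasing: "m < n \<Longrightarrow> branch_seq S n < branch_seq S m"
  using lift_Suc_mono_less[of "branch_code S", OF branch_code_less_Suc]
  by (simp add: branch_seq_def frac_less2)

lemma branch_seq_pos_Rats: "range (branch_seq S) \<subseteq> {q \<in> \<rat>. 0 < q}"
  by (auto simp: branch_seq_def add_pos_nonneg)

lemma infinite_range_branch_seq: "infinite (range (branch_seq S))"
proof -
  have "inj (branch_seq S)"
    by (intro linorder_injI) (metis branch_seq_decreasing less_irrefl)
  then show ?thesis
    by (rule range_inj_infinite)
qed

text \<open>If \<open>k\<close> separates \<open>S\<close> from \<open>T\<close>, codes with index
  above \<open>k\<close> record this, so common terms have index at most \<open>k\<close>.\<close>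

lemma almost_disjoint_branch_seq:
  assumes "S \<noteq> T"
  shows "finite (range (branch_seq S) \<inter> range (branch_seq T))"
proof -
  obtain k where k: "k \<in> S \<longleftrightarrow> k \<notin> T"
    using assms by auto
  have "range (branch_seq S) \<inter> range (branch_seq T) \<subseteq> branch_seq S ` {..k}"
  proof
    fix t assume "t \<in> range (branch_seq S) \<inter> range (branch_seq T)"
    then obtain m n where mn: "t = branch_seq S m" "t = branch_seq T n"
      by blast
    then have "branch_code S m = branch_code T n"
      by (simp add: branch_seq_def)
    then have "m = n" "S \<inter> {..<m} = T \<inter> {..<n}"
      using branch_code_eq by blast+
    then have "\<not> k < m"
      using k by (auto simp: set_eq_iff)
    then show "t \<in> branch_seq S ` {..k}"
      using mn by auto
  qed
  then show ?thesis
    using finite_subset by blast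
qed

lemma finite_branch_seq_above:
  assumes "0 < r"
  shows "finite (range (branch_seq S) \<inter> {r..})"
proof -
  have "range (branch_seq S) \<inter> {r..} \<subseteq> (\<lambda>k. 1 / (1 + real k)) ` {..nat \<lceil>1 / r\<rceil>}"
  proof
    fix t assume t: "t \<in> range (branch_seq S) \<inter> {r..}"
    then obtain k where k: "t = 1 / (1 + real k)"
      by (auto simp: branch_seq_def)
    with t have "r * (1 + real k) \<le> 1"
      by (simp add: pos_le_divide_eq)
    with assms have "real k \<le> 1 / r"
      by (simp add: field_simps)
    then have "k \<le> nat \<lceil>1 / r\<rceil>"
      by linarith
    with k show "t \<in> (\<lambda>k. 1 / (1 + real k)) ` {..nat \<lceil>1 / r\<rceil>}"
      by blast
  qed
  then show ?thesis
    using finite_subset by blast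
qed

section \<open>Ideals generated by branch sequences\<close>

text \<open>The ideal on \<open>V\<close> generated by the finite sets and the parts in
  \<open>V\<close> of the sequences indexed by \<open>\<Gamma>\<close>.\<close>

definition branch_ideal :: "real set \<Rightarrow> nat set set \<Rightarrow> real set set"
  where "branch_ideal V \<Gamma> =
    {X. X \<subseteq> V \<and> (\<exists>\<Delta>\<subseteq>\<Gamma>. finite \<Delta> \<and> finite (X - (\<Union>S\<in>\<Delta>. range (branch_seq S))))}"

lemma branch_ideal_mono: "\<Gamma> \<subseteq> \<Gamma>' \<Longrightarrow> branch_ideal V \<Gamma> \<subseteq> branch_ideal V \<Gamma>'"
  unfolding branch_ideal_def by blast

text \<open>For \<open>S\<close> outside \<open>\<Gamma>\<close>, finitely many other sequences
  cover only finitely many terms of the infinite sequence of \<open>S\<close>, by almost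
  disjointness.\<close>

lemma range_branch_seq_in_ideal:
  assumes "range (branch_seq S) \<subseteq> V"
  shows "range (branch_seq S) \<in> branch_ideal V \<Gamma> \<longleftrightarrow> S \<in> \<Gamma>"
proof
  assume "S \<in> \<Gamma>"
  then show "range (branch_seq S) \<in> branch_ideal V \<Gamma>"
    unfolding branch_ideal_def using assms by (auto intro!: exI[of _ "{S}"])
next
  assume "range (branch_seq S) \<in> branch_ideal V \<Gamma>"
  then obtain \<Delta> where \<Delta>: "\<Delta> \<subseteq> \<Gamma>" "finite \<Delta>"
    "finite (range (branch_seq S) - (\<Union>S\<in>\<Delta>. range (branch_seq S)))"
    unfolding branch_ideal_def by blast
  show "S \<in> \<Gamma>"
  proof (rule ccontr)
    assume "S \<notin> \<Gamma>"
    then have "finite (\<Union>T\<in>\<Delta>. range (branch_seq S) \<inter> range (branch_seq T))"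
      using \<Delta> by (intro finite_UN_I almost_disjoint_branch_seq) auto
    with \<Delta>(3) have "finite ((range (branch_seq S) - (\<Union>S\<in>\<Delta>. range (branch_seq S))) \<union>
        (\<Union>T\<in>\<Delta>. range (branch_seq S) \<inter> range (branch_seq T)))"
      by blast
    then have "finite (range (branch_seq S))"
      by (rule finite_subset[rotated]) blast
    then show False
      using infinite_range_branch_seq by blast
  qed
qed

lemma ideal_space_branch_ideal:
  assumes "V \<subseteq> {0<..}" "\<And>t. t \<in> V \<Longrightarrow> e t \<in> K t" "\<And>t. t \<in> V \<Longrightarrow> \<exists>a\<in>K t. a \<noteq> e t"
  shows "ideal_space V (branch_ideal V \<Gamma>) K e"
proof
  fix X r assume "X \<in> branch_ideal V \<Gamma>" and r: "0 < (r::real)"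
  then obtain \<Delta> where \<Delta>: "finite \<Delta>" "finite (X - (\<Union>S\<in>\<Delta>. range (branch_seq S)))"
    unfolding branch_ideal_def by blast
  have "finite (\<Union>S\<in>\<Delta>. range (branch_seq S) \<inter> {r..})"
    using \<Delta>(1) r by (intro finite_UN_I finite_branch_seq_above)
  with \<Delta>(2) have "finite ((X - (\<Union>S\<in>\<Delta>. range (branch_seq S))) \<union> (\<Union>S\<in>\<Delta>. range (branch_seq S) \<inter> {r..}))"
    by blast
  then show "finite (X \<inter> {r..})"
    by (rule finite_subset[rotated]) blast
next
  fix X Y assume "X \<in> branch_ideal V \<Gamma>" "Y \<subseteq> X"
  then show "Y \<in> branch_ideal V \<Gamma>"
    unfolding branch_ideal_def by (blast intro: finite_subset[OF Diff_mono[OF _ order_refl]])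
next
  fix X Y assume XY: "X \<in> branch_ideal V \<Gamma>" "Y \<in> branch_ideal V \<Gamma>"
  obtain \<Delta> where \<Delta>: "\<Delta> \<subseteq> \<Gamma>" "finite \<Delta>" "finite (X - (\<Union>S\<in>\<Delta>. range (branch_seq S)))"
    using XY(1) unfolding branch_ideal_def by blast
  obtain \<Delta>' where \<Delta>': "\<Delta>' \<subseteq> \<Gamma>" "finite \<Delta>'" "finite (Y - (\<Union>S\<in>\<Delta>'. range (branch_seq S)))"
    using XY(2) unfolding branch_ideal_def by blast
  have "finite (X \<union> Y - (\<Union>S\<in>\<Delta> \<union> \<Delta>'. range (branch_seq S)))"
    by (rule finite_subset[OF _ finite_UnI[OF \<Delta>(3) \<Delta>'(3)]]) blast
  then show "X \<union> Y \<in> branch_ideal V \<Gamma>"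
    using XY \<Delta> \<Delta>' unfolding branch_ideal_def by (auto intro!: exI[of _ "\<Delta> \<union> \<Delta>'"])
next
  fix X assume "X \<subseteq> V" "finite X"
  then show "X \<in> branch_ideal V \<Gamma>"
    by (auto simp: branch_ideal_def intro!: exI[of _ "{}"])
qed (use assms in \<open>auto simp: branch_ideal_def\<close>)

section \<open>The chain of length \<open>\<omega>\<^sub>1\<close>\<close>

lemma omega_1_trans_antisym: "trans omega_1" "antisym omega_1"
proof -
  have "Well_order omega_1"
    unfolding omega_1_def by (simp add: cardSuc_Card_order natLeq_Card_order card_order_on_well_order_on)
  then show "trans omega_1" "antisym omega_1"
    by (simp_all add: order_on_defs)
qed

lemma ex_two_in_Field:
  assumes "ctwo \<le>o r"
  shows "\<exists>x\<in>Field r. \<exists>y\<in>Field r. y \<noteq> x"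
proof -
  have "|UNIV :: bool set| \<le>o |Field r|"
    using card_of_mono2[OF assms] by (simp add: ctwo_def Field_card_of)
  then obtain f :: "bool \<Rightarrow> 'a" where "inj f" "range f \<subseteq> Field r"
    by (auto simp: card_of_ordLeq[symmetric])
  then have "f True \<in> Field r" "f False \<in> Field r" "f False \<noteq> f True"
    by (auto dest: injD)
  then show ?thesis
    by blast
qed

theorem theorem2:
  fixes V :: "real set" and s :: "real \<Rightarrow> 'k rel"
  assumes "V \<subseteq> {0..}"
    and "{q \<in> \<rat>. 0 \<le> q} \<subseteq> V"
    and "\<And>r. r \<in> V - {0} \<Longrightarrow> Card_order (s r)"
    and "\<And>r. r \<in> V - {0} \<Longrightarrow> ctwo \<le>o s r"
  shows "\<exists>M :: nat set \<Rightarrow> (real \<Rightarrow> 'k) metric.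
    (\<forall>\<gamma> \<in> Field omega_1.
        ultrametric (M \<gamma>) \<and> homogeneous (M \<gamma>) \<and> Spec (M \<gamma>) = V \<and>
        (\<forall>r \<in> V - {0}. degree_sequence (M \<gamma>) r =o s r)) \<and>
    (\<forall>\<gamma> \<gamma>'. (\<gamma>, \<gamma>') \<in> omega_1 \<and> \<gamma> \<noteq> \<gamma>' \<longrightarrow>
        strictly_isometrically_embeddable (M \<gamma>) (M \<gamma>'))"
proof -
  define W where "W = V - {0}"
  define K where "K r = Field (s r)" for r
  have "\<forall>r\<in>W. \<exists>x\<in>K r. \<exists>y\<in>K r. y \<noteq> x"
    using ex_two_in_Field assms(4) by (auto simp: W_def K_def)
  then obtain e where e: "\<And>r. r \<in> W \<Longrightarrow> e r \<in> K r" "\<And>r. r \<in> W \<Longrightarrow> \<exists>y\<in>K r. y \<noteq> e r"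
    by metis
  \<comment> \<open>Elements of the field of \<open>omega_1\<close> are themselves sets of natural
    numbers, so they serve directly as branch indices. Strict predecessors are taken so that the
    sequence of \<open>\<gamma>\<close> enters only after stage \<open>\<gamma>\<close>.\<close>
  define I where "I \<gamma> = branch_ideal W (underS omega_1 \<gamma>)" for \<gamma>
  define M where "M \<gamma> = ideal_space.space (I \<gamma>) K e" for \<gamma>
  have W_pos: "W \<subseteq> {0<..}"
    using assms(1) by (auto simp: W_def order_le_less)
  have sp: "ideal_space W (I \<gamma>) K e" for \<gamma>
    unfolding I_def using W_pos e by (intro ideal_space_branch_ideal)
  have branch_W: "range (branch_seq S) \<subseteq> W" for S
  proof
    fix t assume "t \<in> range (branch_seq S)"
    then have "t \<in> \<rat>" "0 < t"
      using branch_seq_pos_Rats[of S] by blast+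
    then show "t \<in> W"
      using assms(2) by (auto simp: W_def)
  qed
  have "insert 0 W = V"
    using assms(2) by (auto simp: W_def)
  moreover have "|K r| =o s r" if "r \<in> W" for r
    using that assms(3) by (auto simp: K_def W_def intro: card_of_Field_ordIso)
  ultimately have "ultrametric (M \<gamma>) \<and> homogeneous (M \<gamma>) \<and> Spec (M \<gamma>) = V \<and>
      (\<forall>r \<in> V - {0}. degree_sequence (M \<gamma>) r =o s r)" for \<gamma>
    using ideal_space.ultrametric_space[OF sp] ideal_space.homogeneous_space[OF sp]
      ideal_space.Spec_space[OF sp] ideal_space.degree_sequence_space[OF sp] ordIso_transitive
    unfolding M_def W_def[symmetric] by blast
  moreover have "strictly_isometrically_embeddable (M \<gamma>) (M \<gamma>')"
    if less: "(\<gamma>, \<gamma>') \<in> omega_1" "\<gamma> \<noteq> \<gamma>'" for \<gamma> \<gamma>'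
  proof -
    have "underS omega_1 \<gamma> \<subseteq> underS omega_1 \<gamma>'"
      using less omega_1_trans_antisym by (auto simp: underS_def dest: transD antisymD)
    then have "isometrically_embeddable (M \<gamma>) (M \<gamma>')"
      unfolding M_def by (intro embeddable_mono[OF sp sp]) (simp add: I_def branch_ideal_mono)
    \<comment> \<open>The sequence of \<open>\<gamma>\<close> itself is the obstruction to embedding
      the later space into the earlier one.\<close>
    moreover have "range (branch_seq \<gamma>) \<in> I \<gamma>'" "range (branch_seq \<gamma>) \<notin> I \<gamma>"
      using less by (auto simp: I_def range_branch_seq_in_ideal[OF branch_W] underS_def)
    then have "\<not> isometrically_embeddable (M \<gamma>') (M \<gamma>)"
      using decreasing_sequence_in_ideal[OF sp sp] branch_seq_decreasing unfolding M_def by blast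
    ultimately show ?thesis
      by (simp add: strictly_isometrically_embeddable_def)
  qed
  ultimately show ?thesis
    by blast
qed

end
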